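(* Let $(X,d)$ be a metric space, let $T:X\to X$ be a self-mapping, let $\varphi:X\to[0,\infty)$ be a given function, and let $\rho:=\inf\{d(Tx,x): x\in X,\ x\neq Tx\}$. Let $x_0\in X$ and suppose that $T$ is a type $1$ $\varphi_{x_0}$-contraction with the point $x_0$ and the function $\varphi$. If $\varphi(x_0)=0$ and $\varphi(x)\leq d(Tx,x)$ for all $x\in D_{x_0,\rho}$, then the disc $D_{x_0,\rho}$ is a $\varphi$-fixed disc of $T$.
   Context: Notation: $Fix(T)=\{x\in X: Tx=x\}$, $Z_\varphi=\{x\in X:\varphi(x)=0\}$, and $D_{x_0,r}=\{x\in X: d(x,x_0)\leq r\}$. A disc $D_{x_0,r}$ is a $\varphi$-fixed disc of $T$ if and only if $D_{x_0,r}\subseteq Fix(T)\cap Z_\varphi$. $T$ is a type $1$ $\varphi_{x_0}$-contraction if there is some $k\in(0,1)$ such that, for all $x\in X$, $d(Tx,x)>0$ implies $\max\{d(x,Tx),\varphi(Tx),\varphi(x)\}\leq k\max\{d(x,x_0),\varphi(x),\varphi(x_0)\}$. *)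

theory Defs
  imports "HOL-Analysis.Abstract_Metric_Spaces" "HOL-Library.Extended_Real"
begin

definition Fix :: "'a set \<Rightarrow> ('a \<Rightarrow> 'a) \<Rightarrow> 'a set" where
  "Fix X T = {x \<in> X. T x = x}"

definition zero_set :: "'a set \<Rightarrow> ('a \<Rightarrow> real) \<Rightarrow> 'a set" where
  "zero_set X \<phi> = {x \<in> X. \<phi> x = 0}"

(* The radius is an extended real so that discs of radius rho below also make sense when
   T is the identity; the disc of radius \<infinity> is all of X. *)
definition disc :: "'a set \<Rightarrow> ('a \<Rightarrow> 'a \<Rightarrow> real) \<Rightarrow> 'a \<Rightarrow> ereal \<Rightarrow> 'a set" where
  "disc X d x0 r = {x \<in> X. ereal (d x x0) \<le> r}"

definition phi_fixed_disc ::
  "'a set \<Rightarrow> ('a \<Rightarrow> 'a \<Rightarrow> real) \<Rightarrow> ('a \<Rightarrow> 'a) \<Rightarrow> ('a \<Rightarrow> real) \<Rightarrow> 'a \<Rightarrow> ereal \<Rightarrow> bool" where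
  "phi_fixed_disc X d T \<phi> x0 r \<longleftrightarrow> disc X d x0 r \<subseteq> Fix X T \<inter> zero_set X \<phi>"

definition type1_phi_contraction ::
  "'a set \<Rightarrow> ('a \<Rightarrow> 'a \<Rightarrow> real) \<Rightarrow> ('a \<Rightarrow> 'a) \<Rightarrow> ('a \<Rightarrow> real) \<Rightarrow> 'a \<Rightarrow> bool" where
  "type1_phi_contraction X d T \<phi> x0 \<longleftrightarrow>
     (\<exists>k::real. 0 < k \<and> k < 1 \<and>
        (\<forall>x\<in>X. d (T x) x > 0 \<longrightarrow>
           Max {d x (T x), \<phi> (T x), \<phi> x} \<le> k * Max {d x x0, \<phi> x, \<phi> x0}))"

(* Taken in the extended reals: it is the usual real infimum when T moves some point of X,
   and \<infinity> (the infimum of the empty set) when T is the identity on X. *)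
definition rho :: "'a set \<Rightarrow> ('a \<Rightarrow> 'a \<Rightarrow> real) \<Rightarrow> ('a \<Rightarrow> 'a) \<Rightarrow> ereal" where
  "rho X d T = Inf {ereal (d (T x) x) | x. x \<in> X \<and> x \<noteq> T x}"

end

theory Submission
  imports Defs
begin

text \<open>A moved point x of the disc would satisfy \<open>d x x0\<close> \<le>
  \<open>rho X d T\<close> \<le> \<open>d (T x) x\<close>, since its own displacement enters the
  infimum. Together with the bound on \<open>\<phi> x\<close> and \<open>\<phi> x0 = 0\<close>, its
  displacement then dominates the whole right-hand maximum of the contraction, while it is an entry
  of the left-hand one. So it would be at most \<open>k\<close> times itself, which is absurd for a
  positive number.\<close>

theorem theorem2p2:
  fixes X :: "'a set" and d :: "'a \<Rightarrow> 'a \<Rightarrow> real"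
    and T :: "'a \<Rightarrow> 'a" and \<phi> :: "'a \<Rightarrow> real" and x0 :: 'a
  assumes "Metric_space X d"
    and "T \<in> X \<rightarrow> X"
    and "\<phi> \<in> X \<rightarrow> {0..}"
    and "x0 \<in> X"
    and "type1_phi_contraction X d T \<phi> x0"
    and "\<phi> x0 = 0"
    and "\<And>x. x \<in> disc X d x0 (rho X d T) \<Longrightarrow> \<phi> x \<le> d (T x) x"
  shows "phi_fixed_disc X d T \<phi> x0 (rho X d T)"
proof -
  interpret Metric_space X d by fact
  obtain k where k: "0 < k" "k < 1"
    and contr: "\<And>x. x \<in> X \<Longrightarrow> d (T x) x > 0 \<Longrightarrow>
      Max {d x (T x), \<phi> (T x), \<phi> x} \<le> k * Max {d x x0, \<phi> x, \<phi> x0}"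
    using assms(5) unfolding type1_phi_contraction_def by blast
  have "T x = x \<and> \<phi> x = 0" if x: "x \<in> disc X d x0 (rho X d T)" for x
  proof -
    have xX: "x \<in> X" and x_le: "ereal (d x x0) \<le> rho X d T"
      using x by (auto simp: disc_def)
    have TxX: "T x \<in> X" using assms(2) xX by auto
    have phi_le: "\<phi> x \<le> d (T x) x" using assms(7) x by blast
    have "T x = x"
    proof (rule ccontr)
      assume ne: "T x \<noteq> x"
      then have pos: "d (T x) x > 0" using xX TxX by simp
      \<comment> \<open>Since x is moved, the infimum is over a nonempty set here; an infinite
        radius, where T moves nothing, cannot occur in this branch.\<close>
      have "rho X d T \<le> ereal (d (T x) x)"
        unfolding rho_def using xX ne by (intro Inf_lower) auto
      with x_le have "ereal (d x x0) \<le> ereal (d (T x) x)"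
        by (rule order_trans)
      then have "d x x0 \<le> d (T x) x" by simp
      then have "Max {d x x0, \<phi> x, \<phi> x0} \<le> d (T x) x"
        using phi_le assms(6) by simp
      then have "k * Max {d x x0, \<phi> x, \<phi> x0} \<le> k * d (T x) x"
        using k by (intro mult_left_mono) auto
      moreover have "d (T x) x \<le> Max {d x (T x), \<phi> (T x), \<phi> x}"
        by (simp add: commute)
      ultimately have "d (T x) x \<le> k * d (T x) x"
        using contr[OF xX pos] by linarith
      then show False using k pos by simp
    qed
    moreover have "0 \<le> \<phi> x" using assms(3) xX by auto
    \<comment> \<open>At a fixed point the bound on \<open>\<phi> x\<close> becomes
      \<open>d x x = 0\<close>, so nonnegativity forces \<open>\<phi> x = 0\<close>.\<close>
    ultimately show ?thesis using phi_le xX by simp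
  qed
  then show ?thesis
    by (auto simp: phi_fixed_disc_def Fix_def zero_set_def disc_def)
qed

end
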